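(* Let $A_2\in\mathbf{C}^{n\times n}$, $B_2\in\mathbf{C}^{n\times m}$ be such that the antilinear system $x^+=A_2^{\#}x^{\#}+B_2^{\#}u^{\#}$ is controllable. Let $F_{11},F_{22}\in\mathbf{R}^{p\times p}$ be real matrices and $F_1=\frac12(F_{11}+F_{22})$, $F_2=\frac12(F_{11}-F_{22})$ (equivalently, $\{F_1,F_2\}_\circ=\mathrm{diag}\{F_{11},F_{22}\}$). Let $N_0(s)$ and $D_0(s)$ be polynomial matrices of sizes $n\times m$ and $m\times m$ satisfying $$sN_0^{\#}(s)-A_2N_0(s)=B_2D_0(s)$$ and $$\mathrm{rank}\begin{bmatrix} N_0(s) & -N_0(-s) \\ D_0(s) & -D_0(-s) \\ N_0^{\#}(s) & N_0^{\#}(-s) \\ D_0^{\#}(s) & D_0^{\#}(-s) \end{bmatrix}=2m,\quad\forall s\in\mathbf{C}.$$ Write $\begin{bmatrix} N_0(s) \\ D_0(s) \end{bmatrix}=\sum_{i=0}^{2\varpi}\begin{bmatrix} N_{0,i} \\ D_{0,i} \end{bmatrix}s^i$ (padding with zero coefficients if necessary). Then complete solutions $(X_+,Y_+,X_-,Y_-)$, with $X_\pm\in\mathbf{C}^{n\times p}$ and $Y_\pm\in\mathbf{C}^{m\times p}$, to the equations $$A_2^{\#}X_+^{\#}+B_2^{\#}Y_+^{\#}=X_+(F_1+F_2),\qquad -A_2^{\#}X_-^{\#}-B_2^{\#}Y_-^{\#}=X_-(F_1-F_2)$$ are given by $$\begin{bmatrix} X_\pm \\ Y_\pm \end{bmatrix}=\sum_{i=0}^{\varpi}\begin{bmatrix}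 N_{0,2i} \\ D_{0,2i} \end{bmatrix}Z_\pm(F_1\pm F_2)^{2i}\pm\sum_{i=0}^{\varpi-1}\begin{bmatrix} N_{0,2i+1} \\ D_{0,2i+1} \end{bmatrix}Z_\pm^{\#}(F_1\pm F_2)^{2i+1},$$ where $Z_\pm=Z_1\pm Z_2^{\#}$ with $Z_1,Z_2\in\mathbf{C}^{m\times p}$ arbitrary (so $Z_+,Z_-\in\mathbf{C}^{m\times p}$ are arbitrary); that is, the solutions are exactly those of this form.
   Context: $A^{\#}$ denotes the entrywise complex conjugate of $A$. For a polynomial matrix $P(s)$, $s$ is treated as a real parameter when conjugating ($s^{\#}=s$), so $P^{\#}(s)$ is obtained by conjugating the coefficients only. The real representation of a pair $\{P_1,P_2\}$ of complex matrices of the same size is $\{P_1,P_2\}_\circ=\begin{bmatrix} \mathrm{Re}(P_1+P_2) & -\mathrm{Im}(P_1+P_2) \\ \mathrm{Im}(P_1-P_2) & \mathrm{Re}(P_1-P_2) \end{bmatrix}$. Here $x^+$ denotes $\dot x(t)$ or $x(t+1)$; controllability of $x^+=A_2^{\#}x^{\#}+B_2^{\#}u^{\#}$ is equivalent to controllability of the matrix pair $\left(\begin{bmatrix} 0 & A_2^{\#} \\ A_2 & 0 \end{bmatrix},\begin{bmatrix} 0 & B_2^{\#} \\ B_2 & 0 \end{bmatrix}\right)$, i.e. $\mathrm{rank}\begin{bmatrix} sI_n & -A_2^{\#} & 0 & B_2^{\#} \\ -A_2 & sI_n & B_2 & 0 \end{bmatrix}=2n$ for all $s\in\mathbf{C}$.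 *)

theory Defs
  imports "HOL-Analysis.Analysis" "HOL-Computational_Algebra.Polynomial"
begin

definition vec_cnj :: "complex^'n \<Rightarrow> complex^'n" where
  "vec_cnj x = (\<chi> i. cnj (x $ i))"

definition mat_cnj :: "complex^'c^'r \<Rightarrow> complex^'c^'r" where
  "mat_cnj A = map_matrix cnj A"

text \<open>Matrices are multiplied with \<open>**\<close>; the class operations \<open>*\<close> and \<open>^\<close> on
  vectors act componentwise, so the matrix power is introduced separately.\<close>

primrec mat_pow :: "'a::semiring_1^'n^'n \<Rightarrow> nat \<Rightarrow> 'a^'n^'n" where
  "mat_pow A 0 = mat 1"
| "mat_pow A (Suc k) = A ** mat_pow A k"

definition vstack :: "'a^'c^'r1 \<Rightarrow> 'a^'c^'r2 \<Rightarrow> 'a^'c^('r1 + 'r2)" where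
  "vstack A B = (\<chi> i. case i of Inl k \<Rightarrow> A $ k | Inr k \<Rightarrow> B $ k)"

definition hstack :: "'a^'c1^'r \<Rightarrow> 'a^'c2^'r \<Rightarrow> 'a^('c1 + 'c2)^'r" where
  "hstack A B = (\<chi> i j. case j of Inl k \<Rightarrow> A $ i $ k | Inr k \<Rightarrow> B $ i $ k)"

text \<open>Polynomial matrices are matrices over \<^typ>\<open>complex poly\<close>. Conjugation treats the
  indeterminate as real: it acts on the coefficients only, so the conjugate of \<open>P\<close>, evaluated
  at a complex \<open>s\<close>, does not conjugate \<open>s\<close>.\<close>

definition pmat_cnj :: "complex poly^'c^'r \<Rightarrow> complex poly^'c^'r" where
  "pmat_cnj P = map_matrix (map_poly cnj) P"

definition pmat_const :: "complex^'c^'r \<Rightarrow> complex poly^'c^'r" where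
  "pmat_const A = map_matrix (\<lambda>a. [:a:]) A"

definition pmat_shift :: "complex poly^'c^'r \<Rightarrow> complex poly^'c^'r" where
  "pmat_shift P = map_matrix (\<lambda>q. [:0, 1:] * q) P"

definition pmat_eval :: "complex poly^'c^'r \<Rightarrow> complex \<Rightarrow> complex^'c^'r" where
  "pmat_eval P s = map_matrix (\<lambda>q. poly q s) P"

definition pmat_coeff :: "complex poly^'c^'r \<Rightarrow> nat \<Rightarrow> complex^'c^'r" where
  "pmat_coeff P i = map_matrix (\<lambda>q. coeff q i) P"

text \<open>Controllability of the antilinear system \<open>x\<^sup>+ = A x\<^sup># + B u\<^sup>#\<close>, where \<open>x\<^sup>+\<close> is the time
  derivative or the forward shift: every state can be steered to every state in finite time.
  As usual for linear time-invariant dynamics, enlarging the class of inputs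
  (e.g. to piecewise continuous ones) does not change the continuous-time notion.\<close>

datatype time_axis = Continuous_Time | Discrete_Time

fun antilinear_controllable ::
    "time_axis \<Rightarrow> complex^'n^'n \<Rightarrow> complex^'m^'n \<Rightarrow> bool" where
  "antilinear_controllable Continuous_Time A B \<longleftrightarrow>
    (\<forall>x0 x1. \<exists>T>0. \<exists>(x :: real \<Rightarrow> complex^'n) (u :: real \<Rightarrow> complex^'m).
      continuous_on {0..T} u \<and> x 0 = x0 \<and> x T = x1 \<and>
      (\<forall>t\<in>{0..T}. (x has_vector_derivative A *v vec_cnj (x t) + B *v vec_cnj (u t))
                    (at t within {0..T})))"
| "antilinear_controllable Discrete_Time A B \<longleftrightarrow>
    (\<forall>x0 x1. \<exists>T. \<exists>(x :: nat \<Rightarrow> complex^'n) (u :: nat \<Rightarrow> complex^'m).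
      x 0 = x0 \<and> x T = x1 \<and>
      (\<forall>t<T. x (Suc t) = A *v vec_cnj (x t) + B *v vec_cnj (u t)))"

end

theory Submission
  imports Defs "HOL-Computational_Algebra.Fundamental_Theorem_Algebra"
begin

text \<open>The lower signs reduce to the upper ones with \<open>- (F\<^sub>1 - F\<^sub>2)\<close> in place of \<open>F\<^sub>1 + F\<^sub>2\<close>, so fix a
  real matrix \<open>F\<close> and consider the real linear operator \<open>L(X, Y) = A\<^sup># X\<^sup># + B\<^sup># Y\<^sup># - X F\<close>.
  Comparing coefficients in the factorization, the formula defines a real linear map \<open>S\<close> with
  \<open>L \<circ> S = 0\<close>. If \<open>S Z = 0\<close> with \<open>Z \<noteq> 0\<close>, then the pair \<open>(Z, Z\<^sup>#)\<close> lies in a space that is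
  invariant under right multiplication by \<open>F\<close>; an eigenvector there contradicts the rank
  condition at its eigenvalue. If \<open>L\<close> is not onto, a matrix orthogonal to its range gives a nonzero
  \<open>C\<close> such that \<open>y = C x\<close> satisfies \<open>y\<^sup>+ = F y\<^sup>#\<close> along every trajectory; then \<open>y\<close> stays zero once it
  is zero, which contradicts controllability. Hence \<open>S\<close> is injective, \<open>L\<close> is surjective, and
  counting dimensions shows that the kernel of \<open>L\<close> is the range of \<open>S\<close>.\<close>

section \<open>Matrix algebra\<close>

lemma matrix_add_rdistrib: "(A + B) ** C = A ** C + B ** (C :: 'a::semiring_1^'p^'n)"
  by (simp add: vec_eq_iff matrix_matrix_mult_def distrib_right sum.distrib)

lemma matrix_mult_minus_left: "(- A) ** B = - (A ** (B :: 'a::ring_1^'p^'n))"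
  by (simp add: vec_eq_iff matrix_matrix_mult_def sum_negf)

lemma matrix_mult_minus_right: "A ** (- B) = - (A ** (B :: 'a::ring_1^'p^'n))"
  by (simp add: vec_eq_iff matrix_matrix_mult_def sum_negf)

lemma matrix_diff_rdistrib: "(A - B) ** C = A ** C - B ** (C :: 'a::ring_1^'p^'n)"
  by (simp add: vec_eq_iff matrix_matrix_mult_def left_diff_distrib sum_subtractf)

lemma matrix_diff_ldistrib: "A ** (B - C) = A ** B - A ** (C :: 'a::ring_1^'p^'n)"
  by (simp add: vec_eq_iff matrix_matrix_mult_def right_diff_distrib sum_subtractf)

lemma matrix_scaleR_left: "(r *\<^sub>R A) ** B = r *\<^sub>R (A ** B :: 'a::real_algebra_1^'p^'m)"
  by (rule scalar_matrix_assoc[symmetric])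

lemma matrix_scaleR_right: "A ** (r *\<^sub>R B) = r *\<^sub>R (A ** B :: 'a::real_algebra_1^'p^'m)"
  by (simp add: matrix_scalar_ac scalar_matrix_assoc)

lemma matrix_sum_ldistrib: "A ** (\<Sum>i\<in>I. f i) = (\<Sum>i\<in>I. A ** (f i :: 'a::semiring_1^'p^'n))"
  by (induction I rule: infinite_finite_induct) (auto simp: matrix_add_ldistrib)

lemma matrix_sum_rdistrib: "(\<Sum>i\<in>I. f i) ** B = (\<Sum>i\<in>I. f i ** (B :: 'a::semiring_1^'p^'n))"
  by (induction I rule: infinite_finite_induct) (auto simp: matrix_add_rdistrib)

lemma mat_mult_left_nth: "(mat c ** A) $ i $ j = c * (A $ i $ j :: 'a::semiring_1)"
  by (simp add: matrix_matrix_mult_def mat_def if_distrib[where f = "\<lambda>x. x * _"] sum.delta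
      cong: if_cong)

lemma mat_mult_right_nth: "(A ** mat c) $ i $ j = A $ i $ j * (c :: 'a::semiring_1)"
  by (simp add: matrix_matrix_mult_def mat_def if_distrib[where f = "\<lambda>x. _ * x"] sum.delta
      cong: if_cong)

lemma mat_commute: "mat c ** A = A ** (mat c :: 'a::comm_semiring_1^'n^'n)"
  by (simp add: vec_eq_iff mat_mult_left_nth mat_mult_right_nth mult.commute)

lemma mat_add: "mat (a + b) = mat a + (mat b :: 'a::monoid_add^'n^'n)"
  by (simp add: vec_eq_iff mat_def)

lemma mat_mult: "mat (a * b) = mat a ** (mat b :: 'a::semiring_1^'n^'n)"
  by (simp add: vec_eq_iff mat_mult_left_nth) (simp add: mat_def)

lemma mat_uminus: "mat (- a) = - (mat a :: 'a::ring_1^'n^'n)"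
  by (simp add: vec_eq_iff mat_def)

lemma mat_pow_commute: "mat_pow F k ** F = F ** mat_pow F k"
  by (induction k) (simp_all add: matrix_mul_assoc[symmetric])

lemma mat_pow_uminus: "mat_pow (- F) k = (if even k then mat_pow F k else - mat_pow (F :: 'a::ring_1^'n^'n) k)"
  by (induction k) (simp_all add: matrix_mult_minus_left matrix_mult_minus_right)

section \<open>Entrywise conjugation of matrices and vectors\<close>

lemma mat_cnj_nth [simp]: "mat_cnj A $ i $ j = cnj (A $ i $ j)"
  by (simp add: mat_cnj_def)

lemma vec_cnj_nth [simp]: "vec_cnj x $ i = cnj (x $ i)"
  by (simp add: vec_cnj_def)

lemma mat_cnj_mat_cnj [simp]: "mat_cnj (mat_cnj A) = A"
  by (simp add: vec_eq_iff)

lemma mat_cnj_0 [simp]: "mat_cnj 0 = 0"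
  by (simp add: vec_eq_iff)

lemma mat_cnj_add: "mat_cnj (A + B) = mat_cnj A + mat_cnj B"
  by (simp add: vec_eq_iff)

lemma mat_cnj_scaleR: "mat_cnj (r *\<^sub>R A) = r *\<^sub>R mat_cnj A"
  by (simp add: vec_eq_iff)

lemma mat_cnj_sum: "mat_cnj (\<Sum>i\<in>I. f i) = (\<Sum>i\<in>I. mat_cnj (f i))"
  by (induction I rule: infinite_finite_induct) (simp_all add: mat_cnj_add)

lemma mat_cnj_mult: "mat_cnj (A ** B) = mat_cnj A ** mat_cnj B"
  by (simp add: vec_eq_iff matrix_matrix_mult_def)

lemma mat_cnj_mat_pow: "mat_cnj (mat_pow A k) = mat_pow (mat_cnj A) k"
proof (induction k)
  case 0
  show ?case by (simp add: vec_eq_iff mat_def)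
qed (simp add: mat_cnj_mult)

lemma vec_cnj_mult: "vec_cnj (A *v x) = mat_cnj A *v vec_cnj x"
  by (simp add: vec_eq_iff matrix_vector_mult_def)

lemma linear_vec_cnj: "linear vec_cnj"
  by (intro linearI) (simp_all add: vec_cnj_def vec_eq_iff)

lemma trace_mat_cnj: "trace (mat_cnj A) = cnj (trace A)"
  by (simp add: trace_def)

lemma sum_even_odd:
  "(\<Sum>k\<le>2 * (w :: nat). f k) = (\<Sum>i\<le>w. f (2 * i)) + (\<Sum>i<w. f (2 * i + 1) :: 'a::comm_monoid_add)"
  by (induction w) (simp_all add: ac_simps)

section \<open>Polynomials in a matrix\<close>

text \<open>Horner evaluation at a square matrix with the product \<open>**\<close>;
  \<open>poly\<close> would use the componentwise product of vectors instead.\<close>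

definition poly_mat :: "'a::comm_ring_1 poly \<Rightarrow> 'a^'n^'n \<Rightarrow> 'a^'n^'n" where
  "poly_mat q F = fold_coeffs (\<lambda>a B. mat a + F ** B) q 0"

lemma poly_mat_0 [simp]: "poly_mat 0 F = 0"
  by (simp add: poly_mat_def)

lemma poly_mat_pCons [simp]: "poly_mat (pCons a q) F = mat a + F ** poly_mat q F"
  by (cases "q = 0 \<and> a = 0") (auto simp: poly_mat_def)

lemma poly_mat_add: "poly_mat (p + q) F = poly_mat p F + poly_mat q F"
proof (induction p arbitrary: q)
  case (pCons a p)
  show ?case
  proof (cases q)
    case (pCons b r)
    thus ?thesis using pCons.IH[of r] by (simp add: mat_add matrix_add_ldistrib ac_simps)
  qed
qed simp

lemma poly_mat_smult: "poly_mat (smult c p) F = mat c ** poly_mat p F"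
  by (induction p)
    (simp_all add: mat_mult matrix_add_ldistrib mat_commute[of c] matrix_mul_assoc[symmetric])

lemma poly_mat_linear_factor: "poly_mat ([:- l, 1:] * q) F = (F - mat l) ** poly_mat q F"
proof -
  have "[:- l, 1:] * q = smult (- l) q + pCons 0 q" by simp
  thus ?thesis
    by (simp only: poly_mat_add poly_mat_smult poly_mat_pCons matrix_diff_rdistrib mat_uminus
        matrix_mult_minus_left mat_0) simp
qed

lemma poly_mat_monom: "poly_mat (monom c k) F = mat c ** mat_pow F k"
proof (induction k)
  case (Suc k)
  have "F ** (mat c ** mat_pow F k) = mat c ** (F ** mat_pow F k)"
    by (metis mat_commute matrix_mul_assoc)
  with Suc show ?case by (simp add: monom_Suc)
qed (simp add: monom_0)

lemma poly_mat_sum: "poly_mat (\<Sum>i\<in>I. f i) F = (\<Sum>i\<in>I. poly_mat (f i) F)"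
  by (induction I rule: infinite_finite_induct) (auto simp: poly_mat_add)

text \<open>The powers of \<open>F\<close> lie in a space of finite real dimension, so some of them
  satisfy a linear relation. Since \<open>dependent\<close> speaks of sets, two coinciding powers
  form a separate case, where a difference of monomials does the job.\<close>

lemma ex_annihilating_poly:
  fixes F :: "complex^'p^'p"
  obtains q where "q \<noteq> 0" "poly_mat q F = 0"
proof (cases "inj (mat_pow F)")
  case False
  then obtain i j where ij: "mat_pow F i = mat_pow F j" "i \<noteq> j"
    by (auto simp: inj_def)
  have "monom (1::complex) i + smult (-1) (monom 1 j) \<noteq> 0"
  proof
    assume "monom (1::complex) i + smult (-1) (monom 1 j) = 0"
    hence "coeff (monom (1::complex) i + smult (-1) (monom 1 j)) i = 0" by simp
    with ij show False by simp
  qed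
  moreover have "poly_mat (monom (1::complex) i + smult (-1) (monom 1 j)) F = 0"
    unfolding poly_mat_add poly_mat_smult poly_mat_monom
    using ij by (simp add: mat_uminus matrix_mult_minus_left)
  ultimately show thesis by (rule that)
next
  case True
  define I where "I = {..DIM(complex^'p^'p)}"
  have inj: "inj_on (mat_pow F) I"
    using True by (auto intro: inj_on_subset)
  have "dependent (mat_pow F ` I)"
    by (rule dependent_biggerset) (simp add: card_image[OF inj], simp add: I_def)
  then obtain c where c: "\<exists>v\<in>mat_pow F ` I. c v \<noteq> 0" "(\<Sum>v\<in>mat_pow F ` I. c v *\<^sub>R v) = 0"
    by (subst (asm) dependent_finite) (auto simp: I_def)
  define q where "q = (\<Sum>i\<in>I. monom (complex_of_real (c (mat_pow F i))) i)"
  from c(1) obtain i where i: "i \<in> I" "c (mat_pow F i) \<noteq> 0" by auto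
  have "coeff q i = complex_of_real (c (mat_pow F i))"
    using i unfolding q_def by (simp add: coeff_sum I_def sum.delta)
  hence "q \<noteq> 0" using i by auto
  moreover have "mat (complex_of_real r) ** M = r *\<^sub>R M" for r and M :: "complex^'p^'p"
    by (simp add: vec_eq_iff mat_mult_left_nth scaleR_conv_of_real[where 'a = complex])
  hence "poly_mat q F = 0"
    using c(2) by (simp add: q_def poly_mat_sum poly_mat_monom sum.reindex[OF inj])
  ultimately show thesis by (rule that)
qed

text \<open>Split an annihilating polynomial into linear factors and multiply \<open>W\<close> by
  them one at a time. The products reach zero eventually, and the last nonzero one is the required
  \<open>V\<close>. The predicate \<open>Q\<close> stands for a set that is stable under these
  multiplications.\<close>

lemma ex_row_eigenmatrix:
  fixes W :: "complex^'p^'c" and F :: "complex^'p^'p"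
  assumes closed: "\<And>W l. Q W \<Longrightarrow> Q (W ** (F - mat l))" and W: "Q W" "W \<noteq> 0"
  obtains V l where "Q V" "V \<noteq> 0" "V ** F = V ** mat l"
proof -
  have "\<exists>V l. Q V \<and> V \<noteq> 0 \<and> V ** F = V ** mat l"
    if "q \<noteq> 0" "W ** poly_mat q F = 0" "Q W" "W \<noteq> 0" for q and W :: "complex^'p^'c"
    using that
  proof (induction "degree q" arbitrary: q W)
    case 0
    then obtain a where a: "q = [:a:]" "a \<noteq> 0"
      by (metis degree_eq_zeroE pCons_0_0)
    \<comment> \<open>A nonzero constant polynomial cannot annihilate a nonzero \<open>W\<close>, so
      this case is contradictory.\<close>
    have "W = W ** mat a ** mat (inverse a)"
      using a by (simp add: matrix_mul_assoc[symmetric] mat_mult[symmetric])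
    with 0 a show ?case by simp
  next
    case (Suc d)
    then obtain l where "poly q l = 0"
      by (metis fundamental_theorem_of_algebra constant_degree Zero_not_Suc)
    then obtain r where r: "q = [:- l, 1:] * r" by (auto simp: poly_eq_0_iff_dvd)
    show ?case
    proof (cases "W ** (F - mat l) = 0")
      case True
      with Suc.prems show ?thesis by (auto simp: matrix_diff_ldistrib)
    next
      case False
      have "r \<noteq> 0" "d = degree r" using Suc.prems(1) Suc.hyps(2) r
        by (auto simp: degree_mult_eq simp del: mult_pCons_left)
      moreover have "W ** (F - mat l) ** poly_mat r F = 0"
        using Suc.prems(2) unfolding r poly_mat_linear_factor by (simp add: matrix_mul_assoc)
      ultimately show ?thesis
        using Suc.hyps(1) closed[OF Suc.prems(3)] False by blast
    qed
  qed
  moreover obtain q where "q \<noteq> 0" "poly_mat q F = 0" by (rule ex_annihilating_poly)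
  ultimately have "\<exists>V l. Q V \<and> V \<noteq> 0 \<and> V ** F = V ** mat l"
    using W by simp
  thus thesis using that by blast
qed

text \<open>The solutions \<open>W\<close> of the matrix equation are stable under right
  multiplication by \<open>F - mat l\<close>, because this commutes with the powers of
  \<open>F\<close>. On an eigenmatrix \<open>V\<close> among them, \<open>F\<close> acts as the
  scalar \<open>l\<close>, so any nonzero column of \<open>V\<close> lies in the kernel of the
  pencil at \<open>l\<close>.\<close>

lemma pencil_kernel_eigenvector:
  fixes M :: "nat \<Rightarrow> complex^'c^'r" and W :: "complex^'p^'c" and F :: "complex^'p^'p"
  assumes "(\<Sum>k\<in>I. M k ** W ** mat_pow F k) = 0" "W \<noteq> 0"
  obtains l v where "v \<noteq> 0" "(\<Sum>k\<in>I. M k *v (l ^ k *s v)) = 0"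
proof -
  let ?Q = "\<lambda>W :: complex^'p^'c. (\<Sum>k\<in>I. M k ** W ** mat_pow F k) = 0"
  have closed: "?Q (W ** (F - mat l))" if "?Q W" for W l
  proof -
    have comm: "(F - mat l) ** mat_pow F k = mat_pow F k ** (F - mat l)" for k
      by (simp only: matrix_diff_ldistrib matrix_diff_rdistrib mat_pow_commute mat_commute[of l])
    have "M k ** (W ** (F - mat l)) ** mat_pow F k = M k ** W ** mat_pow F k ** (F - mat l)" for k
      by (simp only: matrix_mul_assoc[symmetric] comm)
    hence "(\<Sum>k\<in>I. M k ** (W ** (F - mat l)) ** mat_pow F k)
        = (\<Sum>k\<in>I. M k ** W ** mat_pow F k) ** (F - mat l)"
      by (simp only: matrix_sum_rdistrib)
    thus ?thesis using that by simp
  qed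
  obtain V l where V: "?Q V" "V \<noteq> 0" "V ** F = V ** mat l"
    using ex_row_eigenmatrix[of ?Q F W] closed assms by blast
  from V(2) obtain i j where ij: "V $ i $ j \<noteq> 0" by (auto simp: vec_eq_iff)
  have pow: "V ** mat_pow F k = V ** mat (l ^ k)" for k
  proof (induction k)
    case (Suc k)
    have "V ** mat_pow F (Suc k) = V ** mat l ** mat_pow F k"
      by (simp add: matrix_mul_assoc V(3))
    also have "\<dots> = V ** mat_pow F k ** mat l"
      by (simp only: matrix_mul_assoc[symmetric] mat_commute[of l])
    also have "\<dots> = V ** mat (l ^ Suc k)"
      by (simp only: Suc power_Suc2 mat_mult matrix_mul_assoc)
    finally show ?case .
  qed simp
  have "(\<Sum>k\<in>I. M k *v (l ^ k *s column j V)) $ a = (\<Sum>k\<in>I. M k ** V ** mat_pow F k) $ a $ j"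
    for a
  proof -
    have "(M k *v (l ^ k *s column j V)) $ a = (M k ** V ** mat_pow F k) $ a $ j" for k
    proof -
      have "M k ** V ** mat_pow F k = M k ** (V ** mat (l ^ k))"
        by (simp only: matrix_mul_assoc[symmetric] pow)
      thus ?thesis
        by (simp add: matrix_matrix_mult_def[of "M k"] mat_mult_right_nth matrix_vector_mult_def
            column_def mult.commute)
    qed
    thus ?thesis by simp
  qed
  hence "(\<Sum>k\<in>I. M k *v (l ^ k *s column j V)) = 0" by (simp add: vec_eq_iff V(1))
  moreover have "column j V \<noteq> 0" using ij by (auto simp: vec_eq_iff column_def)
  ultimately show thesis using that by blast
qed

section \<open>Controllability\<close>

text \<open>A Gronwall argument: with a bound \<open>K\<close> for \<open>f\<close>, the weighted
  squared norm \<open>exp (- (2 * K) * t) * (y t \<bullet> y t)\<close> is nonincreasing,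
  nonnegative and zero at the start.\<close>

lemma bounded_linear_ode_zero:
  fixes y :: "real \<Rightarrow> 'a::real_inner"
  assumes f: "bounded_linear f" and "0 \<le> T" "y 0 = 0"
    and y: "\<And>t. t \<in> {0..T} \<Longrightarrow> (y has_vector_derivative f (y t)) (at t within {0..T})"
  shows "y T = 0"
proof -
  obtain K where K: "\<And>x. norm (f x) \<le> norm x * K"
    using bounded_linear.bounded[OF f] by blast
  define g where "g t = exp (- (2 * K) * t) * (y t \<bullet> y t)" for t
  define g' where "g' t = exp (- (2 * K) * t) * (2 * (y t \<bullet> f (y t)) - 2 * K * (y t \<bullet> y t))" for t
  have g: "(g has_real_derivative g' t) (at t within {0..T})" if "t \<in> {0..T}" for t
  proof -
    have "((\<lambda>t. y t \<bullet> y t) has_real_derivative 2 * (y t \<bullet> f (y t))) (at t within {0..T})"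
      using has_derivative_inner[OF y[OF that, unfolded has_vector_derivative_def]
          y[OF that, unfolded has_vector_derivative_def]]
      unfolding has_field_derivative_def
      by (rule has_derivative_eq_rhs) (auto simp: inner_commute algebra_simps)
    from this show ?thesis
      unfolding g_def g'_def
      by - (rule derivative_eq_intros refl | assumption | simp add: algebra_simps)+
  qed
  have nonpos: "g' t \<le> 0" for t
  proof -
    have "y t \<bullet> f (y t) \<le> norm (y t) * norm (f (y t))" by (rule norm_cauchy_schwarz)
    also have "\<dots> \<le> norm (y t) * (norm (y t) * K)" by (intro mult_left_mono K) simp
    also have "\<dots> = K * (y t \<bullet> y t)" by (simp add: dot_square_norm power2_eq_square)
    finally show ?thesis unfolding g'_def by (simp add: mult_nonneg_nonpos)
  qed
  have "g T \<le> g 0"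
  proof (rule DERIV_nonpos_imp_decreasing_open[OF \<open>0 \<le> T\<close>])
    show "\<exists>z. (g has_real_derivative z) (at t) \<and> z \<le> 0" if "0 < t" "t < T" for t
      using g[of t] nonpos[of t] that at_within_Icc_at[of 0 t T] by force
    show "continuous_on {0..T} g" using g by (rule DERIV_continuous_on)
  qed
  hence "y T \<bullet> y T \<le> 0" using \<open>y 0 = 0\<close> by (simp add: g_def mult_le_0_iff)
  thus ?thesis by (metis inner_eq_zero_iff inner_ge_zero order_antisym)
qed

text \<open>The input cancels from the evolution of \<open>C *v x t\<close>, which therefore stays
  zero when started at zero. Every state \<open>x1\<close> is reachable from the zero state, so
  \<open>C\<close> kills all of them.\<close>

lemma controllable_intertwining_zero:
  fixes C :: "complex^'n^'p"
  assumes ctrl: "antilinear_controllable time A B"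
    and CA: "C ** A = F ** mat_cnj C" and CB: "C ** B = 0"
  shows "C = 0"
proof -
  have step: "C *v (A *v vec_cnj x + B *v vec_cnj u) = F *v vec_cnj (C *v x)" for x u
    by (simp add: matrix_vector_right_distrib matrix_vector_mul_assoc CA CB vec_cnj_mult)
  have zero: "C *v x1 = 0" for x1
  proof (cases time)
    case Continuous_Time
    with ctrl obtain T x u where T: "T > 0" and x: "x 0 = 0" "x T = x1"
      and x': "\<And>t. t\<in>{0..T} \<Longrightarrow> (x has_vector_derivative A *v vec_cnj (x t) + B *v vec_cnj (u t)) (at t within {0..T})"
      unfolding Continuous_Time antilinear_controllable.simps by metis
    have "C *v x T = 0"
    proof (rule bounded_linear_ode_zero[of "\<lambda>z. F *v vec_cnj z" T "\<lambda>t. C *v x t"])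
      have "linear (\<lambda>z::complex^'p. F *v vec_cnj z)"
        using linear_compose[OF linear_vec_cnj matrix_vector_mul_linear[of F]] by (simp add: o_def)
      thus "bounded_linear (\<lambda>z::complex^'p. F *v vec_cnj z)"
        by (simp add: linear_conv_bounded_linear)
      show "((\<lambda>t. C *v x t) has_vector_derivative F *v vec_cnj (C *v x t)) (at t within {0..T})"
        if "t \<in> {0..T}" for t
        using bounded_linear.has_vector_derivative[OF matrix_vector_mul_bounded_linear[of C] x'[OF that]]
        by (simp add: step)
    qed (use T x in auto)
    thus ?thesis using x by simp
  next
    case Discrete_Time
    with ctrl obtain T x u where x: "x 0 = 0" "x T = x1"
      and x': "\<And>t. t < T \<Longrightarrow> x (Suc t) = A *v vec_cnj (x t) + B *v vec_cnj (u t)"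
      unfolding Discrete_Time antilinear_controllable.simps by metis
    have "t \<le> T \<Longrightarrow> C *v x t = 0" for t
    proof (induction t)
      case (Suc t)
      thus ?case using x'[of t] by (simp add: step linear_0[OF linear_vec_cnj])
    qed (simp add: x)
    thus ?thesis using x by blast
  qed
  show ?thesis by (rule matrix_eq[THEN iffD2]) (simp add: zero)
qed

section \<open>Orthogonality of complex matrices through the trace\<close>

lemma trace_sub: "trace (A - B) = trace A - trace (B :: 'a::ring_1^'n^'n)"
  by (simp add: trace_def sum_subtractf)

lemma inner_matrix_trace:
  "V \<bullet> M = Re (trace (transpose (mat_cnj V) ** (M :: complex^'c^'r)))"
proof -
  have "V \<bullet> M = (\<Sum>i\<in>UNIV. \<Sum>j\<in>UNIV. Re (cnj (V $ i $ j) * M $ i $ j))"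
    by (simp add: inner_vec_def inner_complex_def)
  also have "\<dots> = Re (trace (transpose (mat_cnj V) ** M))"
    by (subst sum.swap) (simp add: trace_def matrix_matrix_mult_def transpose_def)
  finally show ?thesis .
qed

text \<open>Testing with the adjoint of \<open>N\<close> yields its squared norm.\<close>

lemma Re_trace_mult_eq_0_imp:
  fixes N :: "complex^'r^'c"
  assumes "\<And>X. Re (trace (N ** X)) = 0"
  shows "N = 0"
proof -
  have "transpose (mat_cnj N) \<bullet> transpose (mat_cnj N) = 0"
    unfolding inner_matrix_trace using assms[of "transpose (mat_cnj N)"]
    by (simp add: transpose_def mat_cnj_def vec_eq_iff map_matrix_def)
  hence "transpose (mat_cnj N) = 0" by simp
  thus ?thesis by (simp add: vec_eq_iff transpose_def)
qed

text \<open>With \<open>C\<close> the adjoint of \<open>V\<close>, orthogonality to the range of the Sylvester operator amounts to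
  \<open>C A = F C\<^sup>#\<close> and \<open>C B = 0\<close>, so the output \<open>C x\<close> would evolve independently of the input.\<close>

lemma controllable_orthogonal_sylvester_zero:
  fixes A :: "complex^'n^'n" and B :: "complex^'m^'n" and F :: "complex^'p^'p"
  assumes ctrl: "antilinear_controllable time A B" and F: "mat_cnj F = F"
    and V: "\<And>X Y. V \<bullet> (A ** mat_cnj X + B ** mat_cnj Y - X ** F) = 0"
  shows "V = 0"
proof -
  define C where "C = transpose (mat_cnj V)"
  have V': "Re (trace (C ** (A ** mat_cnj X + B ** mat_cnj Y - X ** F))) = 0" for X Y
    using V unfolding inner_matrix_trace C_def .
  \<comment> \<open>Test with \<open>X = 0\<close> and a conjugated \<open>Y\<close>, so that the
    two conjugations cancel.\<close>
  have "Re (trace ((C ** B) ** Y)) = 0" for Y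
    using V'[of 0 "mat_cnj Y"] by (simp add: matrix_mul_assoc)
  hence CB: "C ** B = 0" by (rule Re_trace_mult_eq_0_imp)
  \<comment> \<open>Test with \<open>Y = 0\<close>. Cyclicity brings \<open>F\<close> to the front;
    the real part is unchanged by conjugation, which moves the conjugation from \<open>X\<close> to
    \<open>C\<close> because \<open>F\<close> is real.\<close>
  have "Re (trace ((C ** A - F ** mat_cnj C) ** X)) = 0" for X
  proof -
    have "Re (trace (C ** A ** X)) = Re (trace (C ** (mat_cnj X ** F)))"
      using V'[of "mat_cnj X" 0]
      by (simp add: matrix_mul_assoc matrix_diff_ldistrib trace_sub)
    also have "\<dots> = Re (trace (F ** (C ** mat_cnj X)))"
      by (metis matrix_mul_assoc trace_mul_sym)
    also have "\<dots> = Re (trace (mat_cnj (F ** (C ** mat_cnj X))))"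
      by (simp add: trace_mat_cnj)
    also have "\<dots> = Re (trace (F ** mat_cnj C ** X))"
      by (simp add: mat_cnj_mult F matrix_mul_assoc)
    finally show ?thesis by (simp add: matrix_diff_rdistrib trace_sub)
  qed
  hence "C ** A = F ** mat_cnj C"
    using Re_trace_mult_eq_0_imp[of "C ** A - F ** mat_cnj C"] by simp
  from controllable_intertwining_zero[OF ctrl this CB] have "C = 0" .
  thus ?thesis by (simp add: C_def vec_eq_iff transpose_def)
qed

section \<open>Block matrices\<close>

lemma vstack_nth [simp]: "vstack A B $ Inl i = A $ i" "vstack A B $ Inr j = B $ j"
  by (simp_all add: vstack_def)

lemma vec_eq_sum_iff: "(x :: 'a^('m::finite + 'n::finite)) = y \<longleftrightarrow> (\<forall>i. x $ Inl i = y $ Inl i) \<and> (\<forall>j. x $ Inr j = y $ Inr j)"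
  by (simp add: vec_eq_iff split_sum_all)

lemma sum_UNIV_Plus: "(\<Sum>k\<in>(UNIV :: ('a::finite + 'b::finite) set). f k) = (\<Sum>i\<in>UNIV. f (Inl i)) + (\<Sum>j\<in>UNIV. f (Inr j))"
  using sum.Plus[of UNIV UNIV f] by (simp add: o_def)

lemma vstack_eq_iff: "vstack A B = vstack C D \<longleftrightarrow> A = C \<and> B = D"
  by (simp add: vec_eq_sum_iff) (simp add: vec_eq_iff)

lemma vstack_mult: "vstack A B ** C = vstack (A ** C) (B ** C)"
  by (simp add: vec_eq_sum_iff) (simp add: vec_eq_iff matrix_matrix_mult_def)

lemma hstack_mult_vstack: "hstack A B ** vstack C D = A ** C + B ** D"
  by (simp add: vec_eq_iff matrix_matrix_mult_def hstack_def sum_UNIV_Plus)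

lemma vstack_add: "vstack A B + vstack C D = vstack (A + C) (B + D)"
  by (simp add: vec_eq_sum_iff)

lemma vstack_diff: "vstack A B - vstack C D = vstack (A - C) (B - D)"
  by (simp add: vec_eq_sum_iff)

lemma vstack_0: "vstack 0 0 = 0"
  by (simp add: vec_eq_sum_iff)

lemma vstack_sum: "(\<Sum>i\<in>I. vstack (f i) (g i)) = vstack (sum f I) (sum g I)"
  by (induction I rule: infinite_finite_induct) (simp_all add: vstack_0 vstack_add)

lemma sum_vstack_mult_vec_eq_0:
  "(\<Sum>i\<in>I. vstack (f i) (g i) *v x i) = 0 \<longleftrightarrow> (\<Sum>i\<in>I. f i *v x i) = 0 \<and> (\<Sum>i\<in>I. g i *v x i) = 0"
  by (simp add: vec_eq_sum_iff matrix_vector_mult_def) (simp add: vec_eq_iff matrix_vector_mult_def)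

lemma vstack_mult_vec_eq_0: "vstack A B *v x = 0 \<longleftrightarrow> A *v x = 0 \<and> B *v x = 0"
  by (simp add: vec_eq_sum_iff matrix_vector_mult_def) (simp add: vec_eq_iff matrix_vector_mult_def)

lemma hstack_mult_vec: "hstack A B *v x = A *v (\<chi> i. x $ Inl i) + B *v (\<chi> i. x $ Inr i)"
  by (simp add: vec_eq_iff matrix_vector_mult_def hstack_def sum_UNIV_Plus)

text \<open>Full column rank means that the rows span the whole space, which provides a left
  inverse.\<close>

lemma full_column_rank_mult_vec_eq_0:
  fixes A :: "'a::field^'n^'m"
  assumes "rank A = CARD('n)" "A *v x = 0"
  shows "x = 0"
proof -
  have "vec.dim (rows A) = vec.dim (UNIV :: ('a^'n) set)"
    using assms(1) by (simp only: row_rank_def_gen vec_dim_card)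
  hence "vec.span (rows A) = UNIV"
    by (metis vec.dim_eq_full vec.dim_span vec.span_UNIV)
  thus ?thesis
    using assms(2) matrix_left_invertible_span_rows_gen matrix_left_invertible_ker by blast
qed

lemma pmat_eval_mult_vec:
  assumes "\<And>i j. degree (N $ i $ j) \<le> d"
  shows "pmat_eval N s *v a = (\<Sum>k\<le>d. pmat_coeff N k *v (s ^ k *s a))"
proof -
  have "poly (N $ i $ j) s = (\<Sum>k\<le>d. coeff (N $ i $ j) k * s ^ k)" for i j
    unfolding poly_altdef
    by (rule sum.mono_neutral_left) (auto intro: le_trans[OF _ assms] simp: coeff_eq_0)
  thus ?thesis
    by (subst vec_eq_iff)
      (auto simp: pmat_eval_def pmat_coeff_def matrix_vector_mult_def sum_distrib_right mult.assoc
        intro: sum.swap)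
qed

lemma pmat_coeff_pmat_cnj: "pmat_coeff (pmat_cnj N) k = mat_cnj (pmat_coeff N k)"
  by (simp add: vec_eq_iff pmat_coeff_def pmat_cnj_def coeff_map_poly)

text \<open>Puts the rank condition at \<open>s\<close> into the parity form in which an eigenvector
  belonging to the pair of \<open>Z\<close> and \<open>mat_cnj Z\<close> delivers its
  equations.\<close>

lemma coprime_imp_trivial_kernel:
  fixes N :: "complex poly^'m^'n" and D :: "complex poly^'m^'k"
  assumes rank: "rank (vstack (hstack (pmat_eval N s) (- pmat_eval N (- s)))
           (vstack (hstack (pmat_eval D s) (- pmat_eval D (- s)))
           (vstack (hstack (pmat_eval (pmat_cnj N) s) (pmat_eval (pmat_cnj N) (- s)))
                   (hstack (pmat_eval (pmat_cnj D) s) (pmat_eval (pmat_cnj D) (- s))))))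
        = 2 * CARD('m)"
    and deg: "\<And>i j. degree (N $ i $ j) \<le> d" "\<And>i j. degree (D $ i $ j) \<le> d"
    and N: "(\<Sum>k\<le>d. pmat_coeff N k *v (s ^ k *s (if even k then u else v))) = 0"
    and D: "(\<Sum>k\<le>d. pmat_coeff D k *v (s ^ k *s (if even k then u else v))) = 0"
    and N': "(\<Sum>k\<le>d. mat_cnj (pmat_coeff N k) *v (s ^ k *s (if even k then v else u))) = 0"
    and D': "(\<Sum>k\<le>d. mat_cnj (pmat_coeff D k) *v (s ^ k *s (if even k then v else u))) = 0"
  shows "u = 0 \<and> v = 0"
proof -
  \<comment> \<open>\<open>s\<^sup>k a - (-s)\<^sup>k b\<close> and \<open>s\<^sup>k a + (-s)\<^sup>k b\<close> pick out \<open>a - b\<close> and \<open>a + b\<close> by the parity of \<open>k\<close>.\<close>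
  define a b where "a = (1/2) *s (u + v)" and "b = (1/2) *s (v - u)"
  have ab: "a - b = u" "a + b = v"
    by (simp_all add: a_def b_def vec_eq_iff field_simps)
  define x :: "complex^('m + 'm)" where "x = (\<chi> i. case i of Inl j \<Rightarrow> a $ j | Inr j \<Rightarrow> b $ j)"
  have x: "(\<chi> i. x $ Inl i) = a" "(\<chi> i. x $ Inr i) = b"
    by (simp_all add: x_def vec_eq_iff)
  have deg': "degree (pmat_cnj N $ i $ j) \<le> d" "degree (pmat_cnj D $ i' $ j') \<le> d" for i j i' j'
    using deg by (simp_all add: pmat_cnj_def degree_map_poly)
  have minus: "P *v a + (- Q) *v b = P *v a - Q *v b" for P Q :: "complex^'m^'r"
    by (simp add: vec_eq_iff matrix_vector_mult_def sum_negf)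
  have "s ^ k *s a - (- s) ^ k *s b = s ^ k *s (if even k then u else v)" for k
    unfolding ab[symmetric] by (simp add: vec_eq_iff algebra_simps)
  hence diff: "pmat_eval P s *v a - pmat_eval P (- s) *v b
      = (\<Sum>k\<le>d. pmat_coeff P k *v (s ^ k *s (if even k then u else v)))"
    if "\<And>i j. degree (P $ i $ j) \<le> d" for P :: "complex poly^'m^'r"
    by (simp add: pmat_eval_mult_vec[OF that] sum_subtractf[symmetric]
        matrix_vector_mult_diff_distrib[symmetric])
  have "s ^ k *s a + (- s) ^ k *s b = s ^ k *s (if even k then v else u)" for k
    unfolding ab[symmetric] by (simp add: vec_eq_iff algebra_simps)
  hence add: "pmat_eval P s *v a + pmat_eval P (- s) *v b
      = (\<Sum>k\<le>d. pmat_coeff P k *v (s ^ k *s (if even k then v else u)))"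
    if "\<And>i j. degree (P $ i $ j) \<le> d" for P :: "complex poly^'m^'r"
    by (simp add: pmat_eval_mult_vec[OF that] sum.distrib[symmetric]
        matrix_vector_right_distrib[symmetric])
  have card: "CARD('m + 'm) = 2 * CARD('m)" by simp
  have "x = 0"
    by (rule full_column_rank_mult_vec_eq_0[OF rank[folded card]])
      (simp only: vstack_mult_vec_eq_0 hstack_mult_vec x minus diff[OF deg(1)] diff[OF deg(2)]
        add[OF deg'(1)] add[OF deg'(2)] pmat_coeff_pmat_cnj N D N' D')
  hence "a = 0" "b = 0" using x by (auto simp: vec_eq_iff)
  thus ?thesis using ab by auto
qed

section \<open>The antilinear Sylvester equation\<close>

text \<open>With a linear right inverse \<open>M\<close> of \<open>L\<close>, the map sending
  \<open>(z, t)\<close> to \<open>S z + M t\<close> is injective between spaces of equal dimension,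
  hence onto. Applying \<open>L\<close> recovers \<open>t\<close>, so elements of the kernel of
  \<open>L\<close> have \<open>t = 0\<close>.\<close>

lemma kernel_subset_range_by_dim:
  fixes S :: "'a::euclidean_space \<Rightarrow> 'b::euclidean_space" and L :: "'b \<Rightarrow> 'c::euclidean_space"
  assumes S: "linear S" "inj S" and L: "linear L" "surj L" and LS: "\<And>z. L (S z) = 0"
    and dim: "DIM('a) + DIM('c) = DIM('b)" and x: "L x = 0"
  obtains z where "x = S z"
proof -
  obtain M where M: "linear M" "L \<circ> M = id"
    using linear_surjective_right_inverse[OF L] by blast
  have LM: "L (M t) = t" for t using M(2) by (metis comp_apply id_apply)
  define g where "g = (\<lambda>(z, t). S z + M t)"
  have g: "linear g"
    unfolding g_def using S(1) M(1)
    by (intro linearI) (auto simp: linear_add linear_scale algebra_simps)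
  have "inj g"
  proof (rule linear_injective_0[OF g, THEN iffD2], safe)
    fix z t assume *: "g (z, t) = 0"
    have "t = L (g (z, t))" by (simp add: g_def linear_add[OF L(1)] LS LM)
    hence t: "t = 0" using * by (simp add: linear_0[OF L(1)])
    hence "S z = 0" using * by (simp add: g_def linear_0[OF M(1)])
    hence "z = 0" using S by (simp add: linear_injective_0)
    with t show "(z, t) = 0" by (simp add: zero_prod_def)
  qed
  hence "dim (range g) = DIM('b)"
    using dim_image_eq[OF g, of UNIV] dim by (simp add: dim_UNIV)
  hence "range g = UNIV"
    using linear_subspace_image[OF g subspace_UNIV] by (metis dim_eq_full span_eq_iff)
  then obtain z t where zt: "x = g (z, t)" by (metis surjD surj_pair)
  hence "L x = t" by (simp add: g_def linear_add[OF L(1)] LS LM)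
  hence "x = S z" using x zt by (simp add: g_def linear_0[OF M(1)])
  thus thesis by (rule that)
qed

text \<open>The solution formula with both parities in one sum. \<open>Z\<close> alternates with its
  conjugate because the antilinear equation conjugates each term on its way to the next power of
  \<open>F\<close>; the result is only real linear in \<open>Z\<close>.\<close>

definition antilinear_sum ::
    "(nat \<Rightarrow> complex^'m^'r) \<Rightarrow> nat \<Rightarrow> complex^'p^'p \<Rightarrow> complex^'p^'m \<Rightarrow> complex^'p^'r" where
  "antilinear_sum P d F Z =
    (\<Sum>k\<le>d. P k ** (if even k then Z else mat_cnj Z) ** mat_pow F k)"

lemma linear_antilinear_sum:
  fixes P :: "nat \<Rightarrow> complex^'m^'r" and F :: "complex^'p^'p"
  shows "linear (antilinear_sum P d F)"
proof (rule linearI)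
  have "(if even k then Y + Z else mat_cnj (Y + Z))
      = (if even k then Y else mat_cnj Y) + (if even k then Z else mat_cnj Z)" 
    for k :: nat and Y Z :: "complex^'p^'m"
    by (simp add: mat_cnj_add)
  thus "antilinear_sum P d F (Y + Z) = antilinear_sum P d F Y + antilinear_sum P d F Z" for Y Z
    by (simp only: antilinear_sum_def matrix_add_ldistrib matrix_add_rdistrib sum.distrib)
  have "(if even k then r *\<^sub>R Z else mat_cnj (r *\<^sub>R Z))
      = r *\<^sub>R (if even k then Z else mat_cnj Z)" for k :: nat and r and Z :: "complex^'p^'m"
    by (simp add: mat_cnj_scaleR)
  thus "antilinear_sum P d F (r *\<^sub>R Z) = r *\<^sub>R antilinear_sum P d F Z" for r Z
    by (simp only: antilinear_sum_def matrix_scaleR_left matrix_scaleR_right scaleR_sum_right)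
qed

text \<open>By the coefficient recursion, term \<open>k + 1\<close> on the left equals term
  \<open>k\<close> on the right, so the two sums agree up to their end terms. This is the conjugate
  of the equation to be solved.\<close>

lemma antilinear_sum_solves:
  assumes F: "mat_cnj F = F"
    and zero: "A ** N 0 + B ** D 0 = 0"
    and Suc: "\<And>k. A ** N (Suc k) + B ** D (Suc k) = mat_cnj (N k)"
    and top: "N d = 0"
  shows "A ** antilinear_sum N d F Z + B ** antilinear_sum D d F Z
    = mat_cnj (antilinear_sum N d F Z) ** F"
proof -
  define Zc where "Zc k = (if even k then Z else mat_cnj Z)" for k :: nat
  define g where "g k = (A ** N k + B ** D k) ** Zc k ** mat_pow F k" for k
  define h where "h k = mat_cnj (N k ** Zc k ** mat_pow F k) ** F" for k
  have g0: "g 0 = 0" by (simp add: g_def zero)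
  have Zc: "mat_cnj (Zc k) = Zc (Suc k)" for k by (simp add: Zc_def)
  have gSuc: "g (Suc k) = h k" for k
    by (simp add: g_def h_def Suc mat_cnj_mult Zc mat_cnj_mat_pow F matrix_mul_assoc[symmetric]
        mat_pow_commute)
  \<comment> \<open>The shift needs one summand beyond \<open>d\<close> on the left; it vanishes
    since \<open>N d = 0\<close>.\<close>
  have "g (Suc d) = 0" by (simp add: gSuc) (simp add: h_def top)
  hence "(\<Sum>k\<le>d. g k) = (\<Sum>k\<le>Suc d. g k)" by simp
  also have "\<dots> = (\<Sum>k\<le>d. h k)" by (simp only: sum.atMost_Suc_shift g0 gSuc) simp
  finally show ?thesis
    by (simp add: g_def h_def antilinear_sum_def Zc_def[symmetric] matrix_sum_ldistrib
        matrix_sum_rdistrib mat_cnj_sum matrix_add_rdistrib sum.distrib matrix_mul_assoc)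
qed

text \<open>The vanishing sums and their conjugates together form one complex linear pencil equation
  for \<open>Z\<close> stacked on \<open>mat_cnj Z\<close>; a kernel vector of the pencil is
  excluded by \<open>ker\<close>.\<close>

lemma antilinear_sum_eq_0_imp:
  fixes N :: "nat \<Rightarrow> complex^'m^'n" and D :: "nat \<Rightarrow> complex^'m^'k"
  assumes F: "mat_cnj F = F"
    and ker: "\<And>s u v.
      (\<Sum>k\<le>d. N k *v (s ^ k *s (if even k then u else v))) = 0 \<Longrightarrow>
      (\<Sum>k\<le>d. D k *v (s ^ k *s (if even k then u else v))) = 0 \<Longrightarrow>
      (\<Sum>k\<le>d. mat_cnj (N k) *v (s ^ k *s (if even k then v else u))) = 0 \<Longrightarrow>
      (\<Sum>k\<le>d. mat_cnj (D k) *v (s ^ k *s (if even k then v else u))) = 0 \<Longrightarrow> u = 0 \<and> v = 0"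
    and N: "antilinear_sum N d F Z = 0" and D: "antilinear_sum D d F Z = 0"
  shows "Z = 0"
proof (rule ccontr)
  assume "Z \<noteq> 0"
  \<comment> \<open>\<open>M\<close> acts on the pair \<open>(Z, Z\<^sup>#)\<close> complex linearly, whereas the sums are only real linear in \<open>Z\<close>.\<close>
  define M where "M k = (if even k
      then vstack (vstack (hstack (N k) 0) (hstack (D k) 0))
                  (vstack (hstack 0 (mat_cnj (N k))) (hstack 0 (mat_cnj (D k))))
      else vstack (vstack (hstack 0 (N k)) (hstack 0 (D k)))
                  (vstack (hstack (mat_cnj (N k)) 0) (hstack (mat_cnj (D k)) 0)))" for k
  define W where "W = vstack Z (mat_cnj Z)"
  have cnj: "(\<Sum>k\<le>d. mat_cnj (P k) ** (if even k then mat_cnj Z else Z) ** mat_pow F k)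
      = mat_cnj (antilinear_sum P d F Z)" for P :: "nat \<Rightarrow> complex^'m^'r"
    by (simp add: antilinear_sum_def mat_cnj_sum mat_cnj_mult mat_cnj_mat_pow F if_distrib[of mat_cnj] cong: if_cong)
  have "M k ** W ** mat_pow F k = vstack
      (vstack (N k ** (if even k then Z else mat_cnj Z) ** mat_pow F k)
              (D k ** (if even k then Z else mat_cnj Z) ** mat_pow F k))
      (vstack (mat_cnj (N k) ** (if even k then mat_cnj Z else Z) ** mat_pow F k)
              (mat_cnj (D k) ** (if even k then mat_cnj Z else Z) ** mat_pow F k))" for k
    by (simp add: M_def W_def vstack_mult hstack_mult_vstack)
  hence "(\<Sum>k\<le>d. M k ** W ** mat_pow F k) = 0"
    using N D by (simp only: vstack_sum cnj antilinear_sum_def[symmetric] mat_cnj_0 vstack_0)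
  moreover have "W \<noteq> 0"
    using \<open>Z \<noteq> 0\<close> vstack_eq_iff[of Z "mat_cnj Z" 0 0] by (auto simp: W_def vstack_0)
  ultimately obtain s x where x: "x \<noteq> 0" "(\<Sum>k\<le>d. M k *v (s ^ k *s x)) = 0"
    by (rule pencil_kernel_eigenvector)
  \<comment> \<open>The halves of the eigenvector need not be conjugate to each other, which is why
    \<open>ker\<close> treats \<open>u\<close> and \<open>v\<close> as independent.\<close>
  define u v where "u = (\<chi> i. x $ Inl i)" and "v = (\<chi> i. x $ Inr i)"
  have parts: "(\<chi> i. (c *s x) $ Inl i) = c *s u" "(\<chi> i. (c *s x) $ Inr i) = c *s v" for c
    by (simp_all add: u_def v_def vec_eq_iff)
  \<comment> \<open>Moving the parity test into the blocks lets the sum over \<open>k\<close> split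
    into four separate row equations.\<close>
  have M': "M k = vstack
      (vstack (if even k then hstack (N k) 0 else hstack 0 (N k))
              (if even k then hstack (D k) 0 else hstack 0 (D k)))
      (vstack (if even k then hstack 0 (mat_cnj (N k)) else hstack (mat_cnj (N k)) 0)
              (if even k then hstack 0 (mat_cnj (D k)) else hstack (mat_cnj (D k)) 0))" for k
    by (simp add: M_def)
  have row1: "(if even k then hstack P 0 else hstack 0 P) *v (s ^ k *s x)
      = P *v (s ^ k *s (if even k then u else v))" for k and P :: "complex^'m^'r"
    by (cases "even k"; simp only: hstack_mult_vec parts if_True if_False) simp_all
  have row2: "(if even k then hstack 0 P else hstack P 0) *v (s ^ k *s x)
      = P *v (s ^ k *s (if even k then v else u))" for k and P :: "complex^'m^'r"
    by (cases "even k"; simp only: hstack_mult_vec parts if_True if_False) simp_all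
  have "u = 0 \<and> v = 0"
    using x(2)[unfolded M' sum_vstack_mult_vec_eq_0 row1 row2] ker[of s u v] by blast
  hence "x = 0" by (simp add: u_def v_def vec_eq_sum_iff) (simp add: vec_eq_iff)
  with x(1) show False ..
qed

lemma antilinear_sylvester_solutions:
  fixes A :: "complex^'n^'n" and B :: "complex^'m^'n" and F :: "complex^'p^'p"
    and N :: "nat \<Rightarrow> complex^'m^'n" and D :: "nat \<Rightarrow> complex^'m^'m"
  assumes ctrl: "antilinear_controllable time (mat_cnj A) (mat_cnj B)"
    and F: "mat_cnj F = F"
    and zero: "A ** N 0 + B ** D 0 = 0"
    and Suc: "\<And>k. A ** N (Suc k) + B ** D (Suc k) = mat_cnj (N k)"
    and top: "N d = 0"
    and ker: "\<And>s u v.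
      (\<Sum>k\<le>d. N k *v (s ^ k *s (if even k then u else v))) = 0 \<Longrightarrow>
      (\<Sum>k\<le>d. D k *v (s ^ k *s (if even k then u else v))) = 0 \<Longrightarrow>
      (\<Sum>k\<le>d. mat_cnj (N k) *v (s ^ k *s (if even k then v else u))) = 0 \<Longrightarrow>
      (\<Sum>k\<le>d. mat_cnj (D k) *v (s ^ k *s (if even k then v else u))) = 0 \<Longrightarrow> u = 0 \<and> v = 0"
  shows "mat_cnj A ** mat_cnj X + mat_cnj B ** mat_cnj Y = X ** F \<longleftrightarrow>
    (\<exists>Z. X = antilinear_sum N d F Z \<and> Y = antilinear_sum D d F Z)"
proof -
  define S where "S Z = (antilinear_sum N d F Z, antilinear_sum D d F Z)" for Z :: "complex^'p^'m"
  define L where "L = (\<lambda>(X, Y). mat_cnj A ** mat_cnj X + mat_cnj B ** mat_cnj Y - X ** F)"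
  have S: "linear S"
    using linear_antilinear_sum[of N d F] linear_antilinear_sum[of D d F]
    by (intro linearI) (auto simp: S_def linear_add linear_scale)
  have L: "linear L"
    by (intro linearI) (auto simp: L_def mat_cnj_add mat_cnj_scaleR matrix_add_ldistrib
        matrix_add_rdistrib matrix_scaleR_left matrix_scaleR_right algebra_simps)
  have LS: "L (S Z) = 0" for Z
  proof -
    have "mat_cnj (A ** antilinear_sum N d F Z + B ** antilinear_sum D d F Z)
        = mat_cnj (mat_cnj (antilinear_sum N d F Z) ** F)"
      by (simp only: antilinear_sum_solves[where A = A and B = B and N = N and D = D, OF F zero Suc top])
    thus ?thesis by (simp add: L_def S_def mat_cnj_add mat_cnj_mult F)
  qed
  have "inj S"
    by (rule linear_injective_0[OF S, THEN iffD2])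
      (auto simp: S_def zero_prod_def intro: antilinear_sum_eq_0_imp[OF F ker])
  \<comment> \<open>A proper range would have a nonzero orthogonal matrix \<open>V\<close>, which
    controllability rules out.\<close>
  moreover have "surj L"
  proof (rule ccontr)
    assume "\<not> surj L"
    moreover have span: "span (range L) = range L"
      using linear_subspace_image[OF L subspace_UNIV] by (simp add: span_eq_iff)
    ultimately have "dim (range L) < DIM(complex^'p^'n)"
      by (metis dim_eq_full dim_subset_UNIV le_neq_implies_less)
    then obtain V where V: "V \<noteq> 0" "\<And>y. y \<in> span (range L) \<Longrightarrow> orthogonal V y"
      by (rule orthogonal_to_subspace_exists) blast
    have "V \<bullet> L (X, Y) = 0" for X Y
      using V(2)[of "L (X, Y)"] span by (simp add: orthogonal_def)
    hence "V = 0"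
      by (intro controllable_orthogonal_sylvester_zero[OF ctrl F]) (simp add: L_def)
    with V(1) show False ..
  qed
  \<comment> \<open>The parameter \<open>Z\<close> has the shape of \<open>Y\<close>, and the values
    of \<open>L\<close> have the shape of \<open>X\<close>, so the dimensions add up
    exactly.\<close>
  moreover have "DIM(complex^'p^'m) + DIM(complex^'p^'n) = DIM((complex^'p^'n) \<times> (complex^'p^'m))"
    by simp
  ultimately have "L (X, Y) = 0 \<longleftrightarrow> (\<exists>Z. (X, Y) = S Z)"
    using kernel_subset_range_by_dim[OF S _ L _ LS] LS by metis
  thus ?thesis by (simp add: L_def S_def)
qed

section \<open>Even and odd terms, signs, and coefficients of the factorization\<close>

lemma antilinear_sum_double:
  "antilinear_sum P (2 * w) F Z =
    (\<Sum>i\<le>w. P (2 * i) ** Z ** mat_pow F (2 * i))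
    + (\<Sum>i<w. P (2 * i + 1) ** mat_cnj Z ** mat_pow F (2 * i + 1))"
  unfolding antilinear_sum_def sum_even_odd by simp

text \<open>Negating \<open>F\<close> changes the sign of its odd powers only, which produces the
  minus sign in the formula for the lower signs.\<close>

lemma antilinear_sum_double_uminus:
  "antilinear_sum P (2 * w) (- F) Z =
    (\<Sum>i\<le>w. P (2 * i) ** Z ** mat_pow F (2 * i))
    - (\<Sum>i<w. P (2 * i + 1) ** mat_cnj Z ** mat_pow F (2 * i + 1))"
  unfolding antilinear_sum_double mat_pow_uminus
  by (simp add: matrix_mult_minus_right sum_negf del: mat_pow.simps)

lemma factorization_coeffs:
  fixes N :: "complex poly^'m^'n" and D :: "complex poly^'m^'k"
  assumes "pmat_shift (pmat_cnj N) - pmat_const A ** N = pmat_const B ** D"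
  shows "A ** pmat_coeff N 0 + B ** pmat_coeff D 0 = 0"
    and "A ** pmat_coeff N (Suc k) + B ** pmat_coeff D (Suc k) = mat_cnj (pmat_coeff N k)"
proof -
  have mult: "pmat_coeff (pmat_const C ** P) k = C ** pmat_coeff P k"
    for C :: "complex^'a^'b" and P :: "complex poly^'c^'a" and k
    by (simp add: vec_eq_iff pmat_coeff_def pmat_const_def matrix_matrix_mult_def coeff_sum)
  have diff: "pmat_coeff (P - Q) k = pmat_coeff P k - pmat_coeff Q k"
    for P Q :: "complex poly^'a^'b" and k
    by (simp add: vec_eq_iff pmat_coeff_def)
  have shift: "pmat_coeff (pmat_shift P) 0 = 0"
    "pmat_coeff (pmat_shift P) (Suc k) = pmat_coeff P k" for P :: "complex poly^'a^'b" and k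
    by (simp_all add: vec_eq_iff pmat_coeff_def pmat_shift_def)
  have coeffs: "pmat_coeff (pmat_shift (pmat_cnj N)) k = A ** pmat_coeff N k + B ** pmat_coeff D k" for k
    using arg_cong[OF assms, of "\<lambda>P. pmat_coeff P k"] unfolding diff mult
    by (metis diff_eq_eq add.commute)
  show "A ** pmat_coeff N 0 + B ** pmat_coeff D 0 = 0"
    using coeffs[of 0] by (simp add: shift)
  show "A ** pmat_coeff N (Suc k) + B ** pmat_coeff D (Suc k) = mat_cnj (pmat_coeff N k)"
    using coeffs[of "Suc k"] by (simp add: shift pmat_coeff_pmat_cnj)
qed

lemma pmat_coeff_above_degree:
  "(\<And>i j. degree (P $ i $ j) \<le> d) \<Longrightarrow> pmat_coeff P (Suc d) = 0"
  by (simp add: vec_eq_iff pmat_coeff_def coeff_eq_0 le_imp_less_Suc)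

theorem corollary1:
  fixes time :: time_axis
    and A2 :: "complex^'n^'n" and B2 :: "complex^'m^'n"
    and F11 F22 :: "real^'p^'p" and F1 F2 :: "complex^'p^'p"
    and N0 :: "complex poly^'m^'n" and D0 :: "complex poly^'m^'m"
    and w :: nat
  assumes controllable: "antilinear_controllable time (mat_cnj A2) (mat_cnj B2)"
    and F1: "F1 = map_matrix complex_of_real ((1/2) *\<^sub>R (F11 + F22))"
    and F2: "F2 = map_matrix complex_of_real ((1/2) *\<^sub>R (F11 - F22))"
    and factorization:
      "pmat_shift (pmat_cnj N0) - pmat_const A2 ** N0 = pmat_const B2 ** D0"
    and coprime: "\<And>s :: complex.
      rank (vstack (hstack (pmat_eval N0 s) (- pmat_eval N0 (- s)))
           (vstack (hstack (pmat_eval D0 s) (- pmat_eval D0 (- s)))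
           (vstack (hstack (pmat_eval (pmat_cnj N0) s) (pmat_eval (pmat_cnj N0) (- s)))
                   (hstack (pmat_eval (pmat_cnj D0) s) (pmat_eval (pmat_cnj D0) (- s))))))
        = 2 * CARD('m)"
    and degree_N0: "\<And>i j. degree (N0 $ i $ j) \<le> 2 * w"
    and degree_D0: "\<And>i j. degree (D0 $ i $ j) \<le> 2 * w"
  shows "\<forall>(Xp :: complex^'p^'n) (Yp :: complex^'p^'m) (Xm :: complex^'p^'n) (Ym :: complex^'p^'m).
    (mat_cnj A2 ** mat_cnj Xp + mat_cnj B2 ** mat_cnj Yp = Xp ** (F1 + F2) \<and>
     - (mat_cnj A2 ** mat_cnj Xm) - mat_cnj B2 ** mat_cnj Ym = Xm ** (F1 - F2))
    \<longleftrightarrow>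
    (\<exists>(Z1 :: complex^'p^'m) (Z2 :: complex^'p^'m) Zp Zm.
      Zp = Z1 + mat_cnj Z2 \<and> Zm = Z1 - mat_cnj Z2 \<and>
      vstack Xp Yp =
        (\<Sum>i\<le>w. vstack (pmat_coeff N0 (2 * i)) (pmat_coeff D0 (2 * i))
                  ** Zp ** mat_pow (F1 + F2) (2 * i))
        + (\<Sum>i<w. vstack (pmat_coeff N0 (2 * i + 1)) (pmat_coeff D0 (2 * i + 1))
                  ** mat_cnj Zp ** mat_pow (F1 + F2) (2 * i + 1)) \<and>
      vstack Xm Ym =
        (\<Sum>i\<le>w. vstack (pmat_coeff N0 (2 * i)) (pmat_coeff D0 (2 * i))
                  ** Zm ** mat_pow (F1 - F2) (2 * i))
        - (\<Sum>i<w. vstack (pmat_coeff N0 (2 * i + 1)) (pmat_coeff D0 (2 * i + 1))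
                  ** mat_cnj Zm ** mat_pow (F1 - F2) (2 * i + 1)))"
proof -
  let ?N = "pmat_coeff N0" and ?D = "pmat_coeff D0"
  let ?S = "\<lambda>F Z. (antilinear_sum ?N (2 * w) F Z, antilinear_sum ?D (2 * w) F Z)"
  \<comment> \<open>The coefficient of degree \<open>2 * w + 1\<close> in the factorization: the
    degree bounds on \<open>N0\<close> and \<open>D0\<close> leave only the shifted top coefficient
    of \<open>N0\<close>, which must vanish.\<close>
  have "?N (2 * w) = mat_cnj (A2 ** ?N (Suc (2 * w)) + B2 ** ?D (Suc (2 * w)))"
    by (simp add: factorization_coeffs(2)[OF factorization])
  also have "\<dots> = 0"
    by (simp only: pmat_coeff_above_degree[OF degree_N0] pmat_coeff_above_degree[OF degree_D0]) simp
  finally have top: "?N (2 * w) = 0" .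
  have sol: "mat_cnj A2 ** mat_cnj X + mat_cnj B2 ** mat_cnj Y = X ** F \<longleftrightarrow> (\<exists>Z. (X, Y) = ?S F Z)"
    if "mat_cnj F = F" for F :: "complex^'p^'p" and X Y
    unfolding prod.inject
    by (rule antilinear_sylvester_solutions[where N = ?N and D = ?D, OF controllable that
          factorization_coeffs[OF factorization] top])
      (rule coprime_imp_trivial_kernel[OF coprime degree_N0 degree_D0])
  \<comment> \<open>The sum is \<open>F11\<close> and the difference is \<open>F22\<close>, both
    with real entries.\<close>
  have real: "mat_cnj (F1 + F2) = F1 + F2" "mat_cnj (- (F1 - F2)) = - (F1 - F2)"
    by (simp_all add: vec_eq_iff F1 F2)
  have flip: "- a - b = c \<longleftrightarrow> a + b = - c" for a b c :: "complex^'p^'n"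
  proof -
    have "- a - b = - (a + b)" by simp
    thus ?thesis by (simp only: minus_equation_iff[of "a + b" c] eq_commute[of "a + b"])
  qed
  have minus: "- (mat_cnj A2 ** mat_cnj X) - mat_cnj B2 ** mat_cnj Y = X ** (F1 - F2) \<longleftrightarrow>
      mat_cnj A2 ** mat_cnj X + mat_cnj B2 ** mat_cnj Y = X ** (- (F1 - F2))" for X Y
    unfolding matrix_mult_minus_right flip ..
  have plus_form: "(X, Y) = ?S (F1 + F2) Z \<longleftrightarrow> vstack X Y =
        (\<Sum>i\<le>w. vstack (?N (2 * i)) (?D (2 * i)) ** Z ** mat_pow (F1 + F2) (2 * i))
        + (\<Sum>i<w. vstack (?N (2 * i + 1)) (?D (2 * i + 1))
                  ** mat_cnj Z ** mat_pow (F1 + F2) (2 * i + 1))" for X Y Z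
    by (simp only: prod.inject antilinear_sum_double vstack_mult vstack_sum vstack_add vstack_eq_iff)
  have minus_form: "(X, Y) = ?S (- (F1 - F2)) Z \<longleftrightarrow> vstack X Y =
        (\<Sum>i\<le>w. vstack (?N (2 * i)) (?D (2 * i)) ** Z ** mat_pow (F1 - F2) (2 * i))
        - (\<Sum>i<w. vstack (?N (2 * i + 1)) (?D (2 * i + 1))
                  ** mat_cnj Z ** mat_pow (F1 - F2) (2 * i + 1))" for X Y Z
    by (simp only: prod.inject antilinear_sum_double_uminus vstack_mult vstack_sum vstack_diff
        vstack_eq_iff)
  \<comment> \<open>Half the sum and the conjugate of half the difference: sharing \<open>Z1\<close>
    and \<open>Z2\<close> puts no constraint on \<open>Zp\<close> and \<open>Zm\<close>, so the two
    equations can be solved separately.\<close>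
  have split: "\<exists>Z1 Z2. Zp = Z1 + mat_cnj Z2 \<and> Zm = Z1 - mat_cnj Z2" for Zp Zm :: "complex^'p^'m"
    by (rule exI[of _ "(1/2) *\<^sub>R (Zp + Zm)"], rule exI[of _ "mat_cnj ((1/2) *\<^sub>R (Zp - Zm))"])
      (simp add: vec_eq_iff field_simps)
  show ?thesis
    unfolding plus_form[symmetric] minus_form[symmetric] minus sol[OF real(1)] sol[OF real(2)]
  proof (intro allI iffI)
    fix Xp Yp Xm Ym
    assume "(\<exists>Z. (Xp, Yp) = ?S (F1 + F2) Z) \<and> (\<exists>Z. (Xm, Ym) = ?S (- (F1 - F2)) Z)"
    then obtain Zp Zm where *: "(Xp, Yp) = ?S (F1 + F2) Zp" "(Xm, Ym) = ?S (- (F1 - F2)) Zm"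
      by blast
    obtain Z1 Z2 where "Zp = Z1 + mat_cnj Z2" "Zm = Z1 - mat_cnj Z2"
      using split[of Zp Zm] by blast
    with * show "\<exists>Z1 Z2 Zp Zm. Zp = Z1 + mat_cnj Z2 \<and> Zm = Z1 - mat_cnj Z2 \<and>
        (Xp, Yp) = ?S (F1 + F2) Zp \<and> (Xm, Ym) = ?S (- (F1 - F2)) Zm"
      by blast
  qed blast
qed

end
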